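(* Let $n \ge 2$ be an integer and let $P_1,\dots,P_n$ be independent random points, each uniformly distributed on the unit square $[0,1]^2$, all defined on a common probability space $(\Omega,\mathcal{F},\mathbb{P})$. Run the algorithm cppMM (described in the context) on the point set $\{P_1,\dots,P_n\}$, and let $N = N_1 + N_2$ be its total number of computational steps, where $N_1$ is the number of steps of the pre-computation phase (computing $\bar\delta$, the extents $w,h$, the rescaling, creating the grid and inserting every point into its bucket, and initialising $\delta$) and $N_2$ is the number of pairwise comparisons (distance evaluations and tests against the current minimum) performed in the search phase. Then the expected running time is of linear order: $$\mathbb{E}[N] \in O(n),$$ i.e. there is a constant $C$ independent of $n$ with $\mathbb{E}[N] \le C n$ for all $n \ge 2$.
   Context: Closest pair of points problem: given $n \ge 2$ points $p_1,\dots,p_n$ in $[0,1]^2$, find two distinct points $p \ne q$ minimising the Euclidean distance $\lVert(p,q)\rVert=\sqrt{(p.x-q.x)^2+(p.y-q.y)^2}$. Upper bound used by the algorithm: for $n \ge 2$ let $$\bar\delta(n)=\min(U_1(n),U_2(n)),\quad U_1(n)=\frac{2}{\sqrt{n\pi + C_n(\sqrt3-\frac{\pi}{2}) + (4\lfloor\sqrt n\rfloor-2)(2-\frac{\pi}{2})}-2},\quad U_2(n)=\frac{1+\sqrt{1+(n-1)\frac{2}{\sqrt3}}}{n-1},$$ where $C_n = n-2$ if $3\le n\le 6$, $C_n=n-1$ if $7\le n\le 9$, and $C_n = 3\lfloor n/2\rfloor - 5 + (n \bmod 2)$ otherwise. (This is a known upper bound on the largest possible minimal pairwise distance of $n$ points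 in the unit square; in particular $\bar\delta(n)\in O(1/\sqrt n)$.) Algorithm cppMM on input $P=\{p_1,\dots,p_n\}\subset[0,1]^2$: 1. Set $\bar\delta \leftarrow \bar\delta(n)$; let $w=\max_{p\in P}p.x-\min_{p\in P}p.x$ and $h=\max_{p\in P}p.y-\min_{p\in P}p.y$; replace $\bar\delta \leftarrow \bar\delta\cdot\sqrt{w h}$. 2. Set $g=\lceil 1/\bar\delta\rceil$ and create a $g\times g$ array $G$ of empty buckets (a two-dimensional array, not a hash table). For each $p\in P$ put $p$ into bucket $G_{i,j}$ with $i=\lfloor p.x/\bar\delta\rfloor+1$, $j=\lfloor p.y/\bar\delta\rfloor+1$ (each insertion costs a constant number of steps). 3. Set $\delta\leftarrow\bar\delta$. For $i=1,\dots,g$ and $j=1,\dots,g$, for each $p_1\in G_{i,j}$ and each $p_2$ in $G_{i,j+1}\cup(G_{i,j}\setminus\{p_1\})\cup G_{i+1,j-1}\cup G_{i+1,j}\cup G_{i+1,j+1}$ (non-existing cells are treated as empty, and each unordered pair within the same cell is compared once): if $\lVert(p_1,p_2)\rVert<\delta$, set $\delta\leftarrow\lVert(p_1,p_2)\rVert$ and record $(p_1,p_2)$ as the current closest pair. 4. Return the recorded pair and $\delta$.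
   Formalization: For n = 2 the bound is claimed only if creating the g×g array has no cost per bucket: with a positive cost per bucket E[N] is infinite for n = 2, since 1/w is not integrable. For all n ≥ 3 the claim holds with any constant step costs. *)

theory Defs
  imports "HOL-Probability.Probability"
begin

section \<open>The a-priori bound on the minimal distance\<close>

type_synonym point = "real \<times> real"

definition C_const :: "nat \<Rightarrow> real" where
  "C_const n =
     (if 3 \<le> n \<and> n \<le> 6 then real n - 2
      else if 7 \<le> n \<and> n \<le> 9 then real n - 1
      else 3 * real (n div 2) - 5 + real (n mod 2))"

definition U1 :: "nat \<Rightarrow> real" where
  "U1 n = 2 / (sqrt (real n * pi + C_const n * (sqrt 3 - pi / 2)
                 + (4 * real_of_int \<lfloor>sqrt (real n)\<rfloor> - 2) * (2 - pi / 2)) - 2)"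

definition U2 :: "nat \<Rightarrow> real" where
  "U2 n = (1 + sqrt (1 + (real n - 1) * (2 / sqrt 3))) / (real n - 1)"

definition delta_bar :: "nat \<Rightarrow> real" where
  "delta_bar n = min (U1 n) (U2 n)"

section \<open>The algorithm, with its step counts\<close>

text \<open>
  The primitive operations of the pre-computation take a constant number of steps each; the
  constants are left arbitrary.  Scanning for the extents and inserting are charged per point,
  creating the array is charged per bucket (a constant overhead of the allocation can be
  absorbed in the other constants).
\<close>

record step_costs =
  bound_cost :: nat
  extent_cost :: nat
  rescale_cost :: nat
  bucket_cost :: nat
  insert_cost :: nat
  init_cost :: nat

definition extent :: "(point \<Rightarrow> real) \<Rightarrow> point list \<Rightarrow> real" where
  "extent coord ps = Max (coord ` set ps) - Min (coord ` set ps)"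

text \<open>
  Both functions below are used with the rescaled bound.  If all points lie on a common
  axis-parallel line, it is 0 and so is the grid size (as \<open>1 / 0 = 0\<close>); for independent
  uniformly distributed points this is a null event.
\<close>

definition rescaled_bound :: "point list \<Rightarrow> real" where
  "rescaled_bound ps = delta_bar (length ps) * sqrt (extent fst ps * extent snd ps)"

definition grid_size :: "real \<Rightarrow> nat" where
  "grid_size \<delta> = nat \<lceil>1 / \<delta>\<rceil>"

text \<open>
  The array is a function on index pairs that is empty outside \<open>{1..g} \<times> {1..g}\<close>: non-existing
  cells are thus empty, and an insertion into a non-existing cell has no effect.  The latter
  can only happen for a point with a coordinate equal to 1, again a null event.
\<close>

type_synonym grid = "int \<times> int \<Rightarrow> point list"

definition cell :: "real \<Rightarrow> point \<Rightarrow> int \<times> int" where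
  "cell \<delta> p = (\<lfloor>fst p / \<delta>\<rfloor> + 1, \<lfloor>snd p / \<delta>\<rfloor> + 1)"

definition insert_point :: "real \<Rightarrow> nat \<Rightarrow> point \<Rightarrow> grid \<Rightarrow> grid" where
  "insert_point \<delta> g p G =
     (let c = cell \<delta> p
      in if c \<in> {1..int g} \<times> {1..int g} then G(c := p # G c) else G)"

definition build_grid :: "real \<Rightarrow> nat \<Rightarrow> point list \<Rightarrow> grid" where
  "build_grid \<delta> g ps = fold (insert_point \<delta> g) ps (\<lambda>_. [])"

text \<open>
  The pairs to be compared for one cell: the list argument runs through the cell itself, and
  each point is paired with the later points of the same cell, so that every unordered pair
  within the cell occurs once.
\<close>

fun cell_pairs :: "point list \<Rightarrow> point list \<Rightarrow> point list \<Rightarrow> (point \<times> point) list" where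
  "cell_pairs us [] rs = []"
| "cell_pairs us (p # ps) rs =
     map (Pair p) (us @ ps @ rs) @ cell_pairs us ps rs"

definition search_pairs :: "nat \<Rightarrow> grid \<Rightarrow> (point \<times> point) list" where
  "search_pairs g G =
     concat [cell_pairs (G (i, j + 1)) (G (i, j)) (G (i + 1, j - 1) @ G (i + 1, j) @ G (i + 1, j + 1)).
               i \<leftarrow> [1..int g], j \<leftarrow> [1..int g]]"

text \<open>The search state: current closest pair, current minimum, number of comparisons so far.\<close>

type_synonym search_state = "(point \<times> point) option \<times> real \<times> nat"

fun compare_pair :: "point \<times> point \<Rightarrow> search_state \<Rightarrow> search_state" where
  "compare_pair (p, q) (best, \<delta>, k) =
     (if dist p q < \<delta> then (Some (p, q), dist p q, Suc k) else (best, \<delta>, Suc k))"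

definition precomputation_steps :: "step_costs \<Rightarrow> point list \<Rightarrow> nat" where
  "precomputation_steps \<kappa> ps =
     bound_cost \<kappa>
     + extent_cost \<kappa> * length ps
     + rescale_cost \<kappa>
     + bucket_cost \<kappa> * (grid_size (rescaled_bound ps))\<^sup>2
     + insert_cost \<kappa> * length ps
     + init_cost \<kappa>"

definition cppMM :: "point list \<Rightarrow> search_state" where
  "cppMM ps =
     (let \<delta> = rescaled_bound ps;
          g = grid_size \<delta>;
          G = build_grid \<delta> g ps
      in fold compare_pair (search_pairs g G) (None, \<delta>, 0))"

definition search_comparisons :: "point list \<Rightarrow> nat" where
  "search_comparisons ps = snd (snd (cppMM ps))"

definition total_steps :: "step_costs \<Rightarrow> point list \<Rightarrow> nat" where
  "total_steps \<kappa> ps = precomputation_steps \<kappa> ps + search_comparisons ps"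

section \<open>Independent uniformly distributed points\<close>

definition iid_uniform_points :: "nat \<Rightarrow> 'w measure \<Rightarrow> (nat \<Rightarrow> 'w \<Rightarrow> point) \<Rightarrow> bool" where
  "iid_uniform_points n M P \<longleftrightarrow>
     prob_space M \<and>
     prob_space.indep_vars M (\<lambda>_. borel) P {1..n} \<and>
     (\<forall>i\<in>{1..n}. distr M borel (P i) = uniform_measure lborel ({0..1} \<times> {0..1}))"

definition expected_steps ::
    "step_costs \<Rightarrow> nat \<Rightarrow> 'w measure \<Rightarrow> (nat \<Rightarrow> 'w \<Rightarrow> point) \<Rightarrow> ennreal" where
  "expected_steps \<kappa> n M P =
     (\<integral>\<^sup>+\<omega>. of_nat (total_steps \<kappa> (map (\<lambda>i. P i \<omega>) [1..<n + 1])) \<partial>M)"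

section \<open>The case of two points\<close>

text \<open>
  For two points the reciprocal of an extent is not integrable, so that already the expected
  number of buckets is infinite.  A linear bound that includes \<open>n = 2\<close> is therefore possible
  only if creating the array is not charged per bucket.
\<close>

lemma nn_integral_inverse_dist_infinite:
  fixes a :: real
  assumes a: "a \<in> {0..1}"
  shows "(\<integral>\<^sup>+x. ennreal (1 / \<bar>a - x\<bar>) * indicator {0..1} x \<partial>lborel) = \<infinity>" (is "?I = _")
proof -
  have lb: "?I \<ge> ennreal (ln (1/2) - ln e)" if e: "0 < e" "e < 1/2" for e :: real
  proof (cases "a \<le> 1/2")
    case True
    have "(\<integral>\<^sup>+x. ennreal (1 / (x - a)) * indicator {a + e..a + 1/2} x \<partial>lborel)
        = ennreal (ln (a + 1/2 - a) - ln (a + e - a))"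
      using e by (intro nn_integral_FTC_Icc) (auto intro!: derivative_eq_intros)
    moreover have "(\<integral>\<^sup>+x. ennreal (1 / (x - a)) * indicator {a + e..a + 1/2} x \<partial>lborel) \<le> ?I"
      using e a True by (intro nn_integral_mono) (auto split: split_indicator)
    ultimately show ?thesis by simp
  next
    case False
    have "(\<integral>\<^sup>+x. ennreal (1 / (a - x)) * indicator {a - 1/2..a - e} x \<partial>lborel)
        = ennreal (- ln (a - (a - e)) - (- ln (a - (a - 1/2))))"
      using e by (intro nn_integral_FTC_Icc) (auto intro!: derivative_eq_intros simp: field_simps)
    moreover have "(\<integral>\<^sup>+x. ennreal (1 / (a - x)) * indicator {a - 1/2..a - e} x \<partial>lborel) \<le> ?I"
      using e a False by (intro nn_integral_mono) (auto split: split_indicator)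
    ultimately show ?thesis by simp
  qed
  have "?I \<ge> of_nat k" for k :: nat
  proof -
    define e where "e = exp (- real k) / 4"
    have "0 < e" by (simp add: e_def)
    moreover have "e < 1/2" using exp_le_one_iff[of "- real k"] by (simp add: e_def del: exp_le_one_iff)
    moreover have "ln (1/2) - ln e = real k + ln 2"
      using ln_realpow[of 2 2] by (simp add: e_def ln_div)
    ultimately have "?I \<ge> ennreal (real k + ln 2)" using lb[of e] by simp
    moreover have "ennreal (real k + ln 2) \<ge> ennreal (real k)" by (intro ennreal_leI) simp
    ultimately show ?thesis unfolding ennreal_of_nat_eq_real_of_nat by (rule order_trans[rotated])
  qed
  then show ?thesis
    by (metis ennreal_Ex_less_of_nat infinity_ennreal_def leD top.not_eq_extremum)
qed

lemma steps_lower: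
  assumes "p \<in> {0..1} \<times> {0..1}" "q \<in> {0..1} \<times> {0..1}" "snd p \<noteq> snd q" "bucket_cost \<kappa> > 0"
  shows "of_nat (total_steps \<kappa> [p, q]) \<ge> ennreal (1 / (9 * \<bar>fst p - fst q\<bar>))"
proof (cases "fst p = fst q")
  case True then show ?thesis by simp
next
  case False
  define w where "w = \<bar>fst p - fst q\<bar>"
  define h where "h = \<bar>snd p - snd q\<bar>"
  have ext: "extent fst [p,q] = w" "extent snd [p,q] = h"
    by (auto simp: extent_def w_def h_def abs_if max_def min_def)
  have w: "0 < w" and h: "0 < h" "h \<le> 1" using False assms by (auto simp: w_def h_def abs_if)
  define \<delta> where "\<delta> = rescaled_bound [p, q]"
  define s where "s = sqrt (2 * pi + (-2) * (sqrt 3 - pi/2) + 2 * (2 - pi/2))"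
  have sq3: "sqrt 3 \<le> 2" "1 \<le> sqrt 3" by (auto intro: real_le_lsqrt)
  have "sqrt 4 < s" unfolding s_def
    using pi_gt3 sq3 by (intro real_sqrt_less_mono) (simp add: algebra_simps)
  then have s: "s > 2" by simp
  have f2: "\<lfloor>sqrt (2::real)\<rfloor> = 1"
    by (rule floor_unique) (auto intro: real_le_lsqrt real_less_lsqrt)
  have U1: "U1 2 > 0" using s by (simp add: U1_def C_const_def s_def f2)
  have "2 \<le> 3 * sqrt 3" using sq3 by linarith
  then have "sqrt (1 + 2 / sqrt 3) \<le> 2" by (intro real_le_lsqrt) (simp_all add: divide_le_eq field_simps)
  then have U2: "U2 2 > 0" "U2 2 \<le> 3" by (auto simp: U2_def add_pos_nonneg)
  have d: "0 < delta_bar 2" "delta_bar 2 \<le> 3" using U1 U2 by (auto simp: delta_bar_def)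
  have \<delta>: "\<delta> = delta_bar 2 * sqrt (w * h)" by (simp add: \<delta>_def rescaled_bound_def ext numeral_2_eq_2)
  then have pos: "\<delta> > 0" using d w h by simp
  have "\<delta>\<^sup>2 = (delta_bar 2)\<^sup>2 * (w * h)" using w h by (simp add: \<delta> power_mult_distrib)
  also have "\<dots> \<le> 3\<^sup>2 * (w * 1)"
    using d w h by (intro mult_mono power_mono) auto
  finally have le: "\<delta>\<^sup>2 \<le> 9 * w" by simp
  have "1 / (9 * w) \<le> 1 / \<delta>\<^sup>2" using le pos w by (intro divide_left_mono) auto
  also have "\<dots> = (1 / \<delta>)\<^sup>2" by (simp add: power_divide)
  also have "\<dots> \<le> (real (grid_size \<delta>))\<^sup>2"
    using pos by (intro power_mono) (auto simp: grid_size_def intro: order_trans[OF le_of_int_ceiling] )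
  also have "\<dots> \<le> real (total_steps \<kappa> [p, q])"
  proof -
    have "(grid_size \<delta>)\<^sup>2 \<le> bucket_cost \<kappa> * (grid_size \<delta>)\<^sup>2" using assms by simp
    also have "\<dots> \<le> total_steps \<kappa> [p, q]"
      by (simp add: total_steps_def precomputation_steps_def \<delta>_def)
    finally show ?thesis by (metis of_nat_le_iff of_nat_power)
  qed
  finally show ?thesis by (simp add: w_def ennreal_of_nat_eq_real_of_nat ennreal_leI)
qed

lemma expected_steps_two_infinite:
  assumes iid: "iid_uniform_points 2 M P" and pos: "bucket_cost \<kappa> > 0"
  shows "expected_steps \<kappa> 2 M P = \<infinity>"
proof -
  interpret prob_space M using iid by (simp add: iid_uniform_points_def)
  define S :: "point set" where "S = {0..1} \<times> {0..1}"
  define U where "U = uniform_measure lborel S"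
  have S: "S = cbox (0,0) (1,1)" by (auto simp: S_def cbox_Pair_eq)
  have Sm[measurable]: "S \<in> sets borel" by (simp add: S)
  have "emeasure lborel S = 1"
    by (simp add: S emeasure_lborel_cbox_eq Basis_prod_def)
  note S1 = this
  then have Ueq: "U = density lborel (indicator S)"
    by (simp add: U_def uniform_measure_def divide_ennreal_def)
  have Uset[measurable_cong]: "sets U = sets borel" by (simp add: U_def)
  have Um: "emeasure U S = 1" using S1 by (simp add: U_def)
  have "prob_space U" unfolding U_def using S1 by (intro prob_space_uniform_measure) auto
  then interpret U: prob_space U .
  have D: "distr M borel (P 1) = U" "distr M borel (P 2) = U"
    using iid by (auto simp: iid_uniform_points_def U_def S_def)
  have iv: "indep_vars (\<lambda>_. borel) P {1..2}" using iid by (simp add: iid_uniform_points_def)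
  have ind: "indep_var borel (P 1) borel (P 2)" 
  proof -
    have "indep_var (Pi\<^sub>M {1} (\<lambda>_. borel)) (\<lambda>\<omega>. restrict (\<lambda>i. P i \<omega>) {1})
                    (Pi\<^sub>M {2} (\<lambda>_. borel)) (\<lambda>\<omega>. restrict (\<lambda>i. P i \<omega>) {2})"
      by (rule indep_var_restrict[OF iv]) auto
    from indep_var_compose[OF this, of "\<lambda>x. x 1" borel "\<lambda>x. x 2" borel]
    show ?thesis by (simp add: comp_def)
  qed
  have rv[measurable]: "P 1 \<in> borel_measurable M" "P 2 \<in> borel_measurable M"
    using iv by (auto simp: indep_vars_def)
  define f :: "point \<times> point \<Rightarrow> ennreal" where
    "f = (\<lambda>z. if fst z \<in> S \<and> snd z \<in> S \<and> snd (fst z) \<noteq> snd (snd z)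
               then ennreal (1 / (9 * \<bar>fst (fst z) - fst (snd z)\<bar>)) else 0)"
  have c[measurable]: "fst \<in> (borel :: point measure) \<rightarrow>\<^sub>M borel" "snd \<in> (borel :: point measure) \<rightarrow>\<^sub>M borel"
    by (auto intro!: borel_measurable_continuous_onI continuous_intros)
  have c2[measurable]: "(\<lambda>z. fst (fst z)) \<in> (borel :: point measure) \<Otimes>\<^sub>M (borel :: point measure) \<rightarrow>\<^sub>M borel"
    "(\<lambda>z. snd (fst z)) \<in> (borel :: point measure) \<Otimes>\<^sub>M (borel :: point measure) \<rightarrow>\<^sub>M borel"
    "(\<lambda>z. fst (snd z)) \<in> (borel :: point measure) \<Otimes>\<^sub>M (borel :: point measure) \<rightarrow>\<^sub>M borel"
    "(\<lambda>z. snd (snd z)) \<in> (borel :: point measure) \<Otimes>\<^sub>M (borel :: point measure) \<rightarrow>\<^sub>M borel"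
    by (auto intro: measurable_compose[OF _ c(1)] measurable_compose[OF _ c(2)])
  have fm[measurable]: "f \<in> borel_measurable (borel \<Otimes>\<^sub>M borel)"
    unfolding f_def by measurable
  have "(\<integral>\<^sup>+\<omega>. f (P 1 \<omega>, P 2 \<omega>) \<partial>M) = (\<integral>\<^sup>+z. f z \<partial>distr M (borel \<Otimes>\<^sub>M borel) (\<lambda>\<omega>. (P 1 \<omega>, P 2 \<omega>)))"
    by (rule nn_integral_distr[symmetric]) measurable
  also have "\<dots> = (\<integral>\<^sup>+z. f z \<partial>(U \<Otimes>\<^sub>M U))"
    using ind unfolding indep_var_distribution_eq D by simp
  also have "\<dots> = (\<integral>\<^sup>+p. \<integral>\<^sup>+q. f (p, q) \<partial>U \<partial>U)"
    by (rule U.nn_integral_fst[symmetric]) (use fm in \<open>simp cong: measurable_cong_sets\<close>)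
  also have "\<dots> = (\<integral>\<^sup>+p. \<infinity> * indicator S p \<partial>U)"
  proof (intro nn_integral_cong)
    fix p :: point
    have "(\<integral>\<^sup>+q. f (p, q) \<partial>U) = \<infinity>" if p: "p \<in> S"
    proof -
      have "(\<integral>\<^sup>+q. f (p, q) \<partial>U) = (\<integral>\<^sup>+q. indicator S q * f (p, q) \<partial>lborel)"
        unfolding Ueq by (subst nn_integral_density) auto
      also have "\<dots> = (\<integral>\<^sup>+z. ennreal (1/9) * (ennreal (1 / \<bar>fst p - fst z\<bar>) * indicator {0..1} (fst z))
                * indicator ({0..1} - {snd p}) (snd z) \<partial>(lborel \<Otimes>\<^sub>M lborel))"
        unfolding lborel_prod using p
        by (intro nn_integral_cong) (auto simp: f_def S_def indicator_def simp flip: ennreal_mult split: if_splits)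
      also have "\<dots> = (\<integral>\<^sup>+x. \<integral>\<^sup>+y. ennreal (1/9) * (ennreal (1 / \<bar>fst p - x\<bar>) * indicator {0..1} x)
                * indicator ({0..1} - {snd p}) y \<partial>lborel \<partial>lborel)"
        by (subst lborel.nn_integral_fst[symmetric]) auto
      also have "\<dots> = (\<integral>\<^sup>+x. ennreal (1/9) * (ennreal (1 / \<bar>fst p - x\<bar>) * indicator {0..1} x) \<partial>lborel)"
      proof -
        have "emeasure lborel ({0..1} - {snd p}) = 1"
          by (subst emeasure_Diff) (use p in \<open>auto simp: S_def\<close>)
        then show ?thesis by (intro nn_integral_cong) (subst nn_integral_cmult_indicator, auto)
      qed
      also have "\<dots> = ennreal (1/9) * \<infinity>"
        by (subst nn_integral_cmult) (use p in \<open>auto simp: nn_integral_inverse_dist_infinite S_def\<close>)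
      also have "\<dots> = \<infinity>" by (simp add: ennreal_mult_eq_top_iff)
      finally show ?thesis .
    qed
    then show "(\<integral>\<^sup>+q. f (p, q) \<partial>U) = \<infinity> * indicator S p"
      by (auto simp: f_def indicator_def)
  qed
  also have "\<dots> = \<infinity>"
    using Um S1 by (subst nn_integral_cmult_indicator) (auto simp: Uset)
  finally have *: "(\<integral>\<^sup>+\<omega>. f (P 1 \<omega>, P 2 \<omega>) \<partial>M) = \<infinity>" .
  have "(\<integral>\<^sup>+\<omega>. f (P 1 \<omega>, P 2 \<omega>) \<partial>M) \<le> expected_steps \<kappa> 2 M P"
    unfolding expected_steps_def
  proof (intro nn_integral_mono)
    fix \<omega>
    show "f (P 1 \<omega>, P 2 \<omega>) \<le> of_nat (total_steps \<kappa> (map (\<lambda>i. P i \<omega>) [1..<2 + 1]))"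
      using steps_lower[of "P 1 \<omega>" "P 2 \<omega>" \<kappa>] pos
      by (auto simp: f_def S_def numeral_2_eq_2 numeral_3_eq_3 indicator_def)
  qed
  with * show ?thesis by (simp add: top_unique)
qed

end

theory Submission
  imports Defs
begin

text \<open>
  For points in the unit square the rescaled bound is at most \<open>U2 n = O(1 / sqrt n)\<close>, so that only
  pairs whose coordinates differ by at most \<open>2 * U2 n\<close> are compared. A given pair of points has this
  property with probability \<open>O(1 / n)\<close>, which makes \<open>O(n)\<close> expected comparisons. The number of
  buckets is \<open>O(n / (w * h))\<close> for the extents \<open>w\<close> and \<open>h\<close>, and the expectation of \<open>1 / (w * h)\<close> is
  bounded uniformly in \<open>n \<ge> 3\<close>, since this already holds for the extents of the first
  three points.
\<close>

section \<open>The a-priori bound is of order \<open>1 / sqrt n\<close>\<close>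

lemma U2_nonneg: "n \<ge> 2 \<Longrightarrow> 0 \<le> U2 n"
  by (simp add: U2_def)

text \<open>With \<open>m = n - 1 \<ge> 1\<close> the numerator of \<open>U2 n\<close> is at most
  \<open>3 * sqrt m\<close>, and \<open>m \<ge> n / 2\<close> turns \<open>9 / m\<close> into
  \<open>18 / n\<close>. The square is bounded because it enters as the area of a
  neighbourhood.\<close>

lemma U2_sq_le:
  assumes "n \<ge> 2"
  shows "(U2 n)\<^sup>2 \<le> 18 / real n"
proof -
  define m where "m = real n - 1"
  have m: "m \<ge> 1" using assms by (simp add: m_def)
  have "2 / sqrt 3 \<le> 2" by (simp add: divide_le_eq)
  then have "m * (2 / sqrt 3) \<le> m * 2" using m by (intro mult_left_mono) auto
  then have "sqrt (1 + m * (2 / sqrt 3)) \<le> sqrt (4 * m)"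
    using m by (intro real_sqrt_le_mono) linarith
  then have "sqrt (1 + m * (2 / sqrt 3)) \<le> 2 * sqrt m"
    by (simp add: real_sqrt_mult)
  then have num: "1 + sqrt (1 + m * (2 / sqrt 3)) \<le> 3 * sqrt m"
    using m real_sqrt_ge_one[of m] by linarith
  have "(U2 n)\<^sup>2 = (1 + sqrt (1 + m * (2 / sqrt 3)))\<^sup>2 / m\<^sup>2"
    by (simp add: U2_def m_def power_divide)
  also have "\<dots> \<le> (3 * sqrt m)\<^sup>2 / m\<^sup>2"
    using num m by (intro divide_right_mono power_mono) auto
  also have "\<dots> = 9 / m"
    using m by (simp add: power_mult_distrib power2_eq_square)
  also have "\<dots> \<le> 18 / real n"
    using m by (simp add: m_def field_simps)
  finally show ?thesis .
qed

text \<open>Both members of the minimum are bounded from below; this limits the number of buckets.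
  From \<open>n = 3\<close> on \<open>C_const n\<close> is nonnegative, whereas
  \<open>C_const 2 = -2\<close>.\<close>

lemma delta_bar_ge:
  assumes n: "n \<ge> 3"
  shows "1 / (2 * sqrt (real n)) \<le> delta_bar n"
proof -
  define A where "A = real n * pi + C_const n * (sqrt 3 - pi / 2)
                 + (4 * real_of_int \<lfloor>sqrt (real n)\<rfloor> - 2) * (2 - pi / 2)"
  have pi: "3 < pi" "pi < 3.2" "0 < 2 - pi / 2" "2 - pi / 2 \<le> 1"
    using pi_approx by simp_all
  have "1.6 \<le> sqrt (3::real)" by (rule real_le_rsqrt) (simp add: power2_eq_square)
  moreover have "sqrt 3 \<le> (2::real)" by (rule real_le_lsqrt) auto
  ultimately have c: "0 \<le> sqrt 3 - pi / 2" "sqrt 3 - pi / 2 \<le> 1"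
    using pi by linarith+
  have C: "0 \<le> C_const n" "C_const n \<le> 2 * real n"
    using n by (auto simp: C_const_def)
  have "1 \<le> sqrt (real n)" using n by simp
  then have f1: "1 \<le> \<lfloor>sqrt (real n)\<rfloor>" by (simp add: le_floor_iff)
  then have f1': "1 \<le> real_of_int \<lfloor>sqrt (real n)\<rfloor>" by linarith
  have sn: "sqrt (real n) \<le> real n" using n by (intro real_le_lsqrt) (auto simp: power2_eq_square)
  have f2: "real_of_int \<lfloor>sqrt (real n)\<rfloor> \<le> real n"
    using sn by linarith
  have t2: "0 \<le> C_const n * (sqrt 3 - pi / 2)" using C c by simp
  have t2': "C_const n * (sqrt 3 - pi / 2) \<le> (2 * real n) * 1" using C c by (intro mult_mono) auto
  have t3: "0 \<le> (4 * real_of_int \<lfloor>sqrt (real n)\<rfloor> - 2) * (2 - pi / 2)"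
    using f1' pi by (intro mult_nonneg_nonneg) linarith+
  have t3': "(4 * real_of_int \<lfloor>sqrt (real n)\<rfloor> - 2) * (2 - pi / 2) \<le> (4 * real n) * 1"
    using f1' f2 pi by (intro mult_mono) linarith+
  \<comment> \<open>\<open>A > 4\<close> makes the denominator \<open>sqrt A - 2\<close> of
    \<open>U1 n\<close> positive, so that an upper bound on it yields a lower bound on
    \<open>U1 n\<close>.\<close>
  have "3 * 3 \<le> real n * pi" using n pi by (intro mult_mono) auto
  then have "4 < A" using t2 t3 by (simp add: A_def)
  then have "sqrt 4 < sqrt A" by (rule real_sqrt_less_mono)
  then have D0: "0 < sqrt A - 2" by simp
  have "real n * pi \<le> real n * 4" using pi by (intro mult_left_mono) auto
  \<comment> \<open>The three summands give \<open>10 * n\<close>; 16 is taken for its square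
    root.\<close>
  then have "A \<le> 16 * real n" using t2' t3' by (simp add: A_def)
  then have "sqrt A \<le> sqrt (16 * real n)" by (rule real_sqrt_le_mono)
  then have "sqrt A - 2 \<le> 4 * sqrt (real n)" by (simp add: real_sqrt_mult)
  then have "2 / (4 * sqrt (real n)) \<le> 2 / (sqrt A - 2)"
    using D0 n by (intro divide_left_mono) auto
  then have 1: "1 / (2 * sqrt (real n)) \<le> U1 n" by (simp add: U1_def A_def)

  \<comment> \<open>The other member: \<open>2 / sqrt 3 \<ge> 1\<close> gives
    \<open>U2 n \<ge> 1 / sqrt m\<close>.\<close>
  define m where "m = real n - 1"
  have m: "m > 0" using n by (simp add: m_def)
  have "1 \<le> 2 / sqrt (3::real)" using \<open>sqrt 3 \<le> 2\<close> by simp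
  then have "m * 1 \<le> m * (2 / sqrt 3)" using m by (intro mult_left_mono) auto
  then have "sqrt m \<le> sqrt (1 + m * (2 / sqrt 3))" by (intro real_sqrt_le_mono) linarith
  then have "sqrt m \<le> 1 + sqrt (1 + m * (2 / sqrt 3))" by linarith
  then have "sqrt m / m \<le> U2 n"
    using m unfolding U2_def m_def[symmetric] by (intro divide_right_mono) auto
  moreover have "sqrt m / m = 1 / sqrt m" using m by (simp add: field_simps)
  moreover have "1 / (2 * sqrt (real n)) \<le> 1 / sqrt m"
  proof (rule divide_left_mono)
    have "sqrt m \<le> sqrt (real n)" by (simp add: m_def)
    moreover have "0 \<le> sqrt (real n)" by simp
    ultimately show "sqrt m \<le> 2 * sqrt (real n)" by linarith
  qed (use m n in auto)
  ultimately show ?thesis using 1 by (simp add: delta_bar_def)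
qed

section \<open>Deterministic bounds on the step counts\<close>

lemma extent_ge:
  assumes "p \<in> set ps" "q \<in> set ps"
  shows "\<bar>coord p - coord q\<bar> \<le> extent coord ps"
proof -
  have "coord r \<le> Max (coord ` set ps)" "Min (coord ` set ps) \<le> coord r" if "r \<in> set ps" for r
    using that by auto
  from this[OF assms(1)] this[OF assms(2)] show ?thesis
    unfolding extent_def by linarith
qed

lemma extent_nonneg: "ps \<noteq> [] \<Longrightarrow> 0 \<le> extent coord ps"
  using extent_ge[of "hd ps" ps "hd ps" coord] by simp

lemma extent_le_1:
  assumes "ps \<noteq> []" "\<And>p. p \<in> set ps \<Longrightarrow> coord p \<in> {0..1}"
  shows "extent coord ps \<le> 1"
proof -
  have "Max (coord ` set ps) \<le> 1" "0 \<le> Min (coord ` set ps)"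
    using assms by auto
  then show ?thesis by (simp add: extent_def)
qed

text \<open>With values in \<open>ennreal\<close>, coinciding coordinates give infinity instead of
  the real default \<open>1 / 0 = 0\<close>, so that upper bounds by this function remain true
  there.\<close>

definition inv_sqrt_dist :: "real \<Rightarrow> real \<Rightarrow> ennreal" where
  "inv_sqrt_dist a x = inverse (ennreal (sqrt \<bar>a - x\<bar>))"

text \<open>
  Three points suffice to make the reciprocal of the extent integrable: the extent dominates the
  geometric mean of two of their distances, each of which enters only with exponent \<open>1/2\<close>.
\<close>

lemma inverse_extent_le:
  assumes "p \<in> set ps" "q \<in> set ps" "r \<in> set ps" and pos: "0 < extent coord ps"
  shows "ennreal (1 / extent coord ps)
           \<le> inv_sqrt_dist (coord p) (coord q) * inv_sqrt_dist (coord p) (coord r)"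
proof -
  define w where "w = extent coord ps"
  have *: "ennreal (1 / sqrt w) \<le> inv_sqrt_dist (coord p) (coord x)" if "x \<in> set ps" for x
  proof -
    have "ennreal (1 / sqrt w) = inverse (ennreal (sqrt w))"
      using pos by (simp add: w_def inverse_ennreal inverse_eq_divide)
    also have "\<dots> \<le> inv_sqrt_dist (coord p) (coord x)"
    proof (cases "coord p = coord x")
      case False
      then show ?thesis
        using extent_ge[of p ps x coord] assms that
        by (auto simp: inv_sqrt_dist_def w_def inverse_ennreal intro!: ennreal_leI le_imp_inverse_le)
    qed (simp add: inv_sqrt_dist_def)
    finally show ?thesis .
  qed
  have "ennreal (1 / w) = ennreal (1 / sqrt w) * ennreal (1 / sqrt w)"
    using pos by (simp add: w_def flip: ennreal_mult)
  also have "\<dots> \<le> inv_sqrt_dist (coord p) (coord q) * inv_sqrt_dist (coord p) (coord r)"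
    using assms by (intro mult_mono *) auto
  finally show ?thesis by (simp add: w_def)
qed

text \<open>The reciprocal square root of the area of the axis-parallel rectangle with opposite
  corners \<open>p\<close> and \<open>q\<close>. A product of two such factors with a common corner
  dominates \<open>1 / (w * h)\<close>.\<close>

definition inv_sqrt_area :: "point \<Rightarrow> point \<Rightarrow> ennreal" where
  "inv_sqrt_area p q = inv_sqrt_dist (fst p) (fst q) * inv_sqrt_dist (snd p) (snd q)"

lemma grid_size_nonpos: "\<delta> \<le> 0 \<Longrightarrow> grid_size \<delta> = 0"
  by (simp add: grid_size_def ceiling_le_iff divide_nonneg_nonpos)

text \<open>From \<open>g \<le> 1 / \<delta> + 1\<close> follows
  \<open>g\<^sup>2 \<le> 2 + 2 / \<delta>\<^sup>2\<close>, and \<open>delta_bar_ge\<close> gives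
  \<open>\<delta>\<^sup>2 \<ge> w * h / (4 * n)\<close>. The remaining factor
  \<open>1 / (w * h)\<close> is estimated by \<open>inverse_extent_le\<close> in each
  coordinate.\<close>

lemma grid_size_sq_le:
  assumes n: "length ps \<ge> 3" and mem: "p \<in> set ps" "q \<in> set ps" "r \<in> set ps"
  shows "of_nat ((grid_size (rescaled_bound ps))\<^sup>2)
           \<le> 2 + ennreal (8 * real (length ps)) * (inv_sqrt_area p q * inv_sqrt_area p r)"
proof -
  define n w h \<delta> where "n = length ps" and "w = extent fst ps" and "h = extent snd ps"
    and "\<delta> = rescaled_bound ps"
  have d: "0 < 1 / (2 * sqrt (real n))" "1 / (2 * sqrt (real n)) \<le> delta_bar n"
    using n delta_bar_ge[of n] by (auto simp: n_def)
  have \<delta>: "\<delta> = delta_bar n * sqrt (w * h)"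
    by (simp add: \<delta>_def rescaled_bound_def n_def w_def h_def)
  show ?thesis
  proof (cases "\<delta> \<le> 0")
    \<comment> \<open>As \<open>delta_bar n > 0\<close>, an extent vanishes here, and the default
      \<open>1 / 0 = 0\<close> makes the grid empty.\<close>
    case True
    then show ?thesis by (simp add: grid_size_nonpos \<delta>_def)
  next
    case False
    have "ps \<noteq> []" using n by auto
    then have "w \<ge> 0" "h \<ge> 0" by (auto simp: w_def h_def extent_nonneg)
    moreover have "w \<noteq> 0" "h \<noteq> 0" using False by (auto simp: \<delta>)
    ultimately have wh: "0 < w" "0 < h" by auto
    have pos: "\<delta> > 0" using False by simp
    have "(1 / (2 * sqrt (real n)))\<^sup>2 * (w * h) \<le> (delta_bar n)\<^sup>2 * (w * h)"
      using d wh by (intro mult_right_mono power_mono) auto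
    also have "\<dots> = \<delta>\<^sup>2" using wh by (simp add: \<delta> power_mult_distrib)
    finally have "w * h / (4 * real n) \<le> \<delta>\<^sup>2" by (simp add: power_divide power_mult_distrib)
    then have "1 / \<delta>\<^sup>2 \<le> 1 / (w * h / (4 * real n))"
      using wh n pos by (intro divide_left_mono mult_pos_pos divide_pos_pos) (auto simp: n_def)
    then have inv: "1 / \<delta>\<^sup>2 \<le> 4 * real n * (1 / w * (1 / h))" by simp
    have "real (grid_size \<delta>) \<le> 1 / \<delta> + 1"
      using pos by (simp add: grid_size_def)
    then have "(real (grid_size \<delta>))\<^sup>2 \<le> (1 / \<delta> + 1)\<^sup>2" by (intro power_mono) auto
    also have "\<dots> \<le> 2 + 2 * (1 / \<delta>\<^sup>2)"
      using sum_squares_bound[of "1 / \<delta>" 1] by (simp add: power2_sum power_divide)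
    also have "\<dots> \<le> 2 + 8 * real n * (1 / w * (1 / h))" using inv by linarith
    finally have "ennreal (real ((grid_size \<delta>)\<^sup>2)) \<le> ennreal (2 + 8 * real n * (1 / w * (1 / h)))"
      by (intro ennreal_leI) simp
    also have "\<dots> = 2 + ennreal (8 * real n) * (ennreal (1 / w) * ennreal (1 / h))"
      using wh by (subst ennreal_plus; (subst ennreal_mult)?; (subst ennreal_mult)?; simp)
    also have "\<dots> \<le> 2 + ennreal (8 * real n) *
        ((inv_sqrt_dist (fst p) (fst q) * inv_sqrt_dist (fst p) (fst r)) *
         (inv_sqrt_dist (snd p) (snd q) * inv_sqrt_dist (snd p) (snd r)))"
      using inverse_extent_le[OF mem, of fst] inverse_extent_le[OF mem, of snd] wh
      by (intro add_left_mono mult_left_mono mult_mono) (auto simp: w_def h_def)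
    finally show ?thesis
      by (simp add: inv_sqrt_area_def n_def \<delta>_def ennreal_of_nat_eq_real_of_nat mult_ac)
  qed
qed

section \<open>The number of comparisons\<close>

text \<open>Only an inequality, since points whose cell lies outside the array are dropped.\<close>

lemma build_grid_length_le:
  "length (build_grid \<delta> g ps c) \<le> length (filter (\<lambda>p. cell \<delta> p = c) ps)"
proof -
  have "length (fold (insert_point \<delta> g) ps G c)
      \<le> length (G c) + length (filter (\<lambda>p. cell \<delta> p = c) ps)" for G
  proof (induction ps arbitrary: G)
    case (Cons p ps)
    show ?case
      using Cons.IH[of "insert_point \<delta> g p G"]
      by (auto simp: insert_point_def Let_def split: if_splits)
  qed simp
  from this[of "\<lambda>_. []"] show ?thesis by (simp add: build_grid_def)
qed

lemma length_cell_pairs_le: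
  "length (cell_pairs us ps rs) \<le> length ps * (length us + length ps + length rs)"
  by (induction us ps rs rule: cell_pairs.induct) (auto simp: algebra_simps)

text \<open>The counter advances whatever the outcome of the test, so the current minimum has no
  influence on it.\<close>

lemma count_comparisons: "snd (snd (fold compare_pair xs (b, \<delta>, k))) = k + length xs"
  by (induction xs arbitrary: b \<delta> k) auto

text \<open>Double counting: the weighted occupancies of cells are regrouped by points. Points
  mapped outside \<open>S\<close> contribute to the right-hand side only.\<close>

lemma sum_count_mult_le:
  assumes "finite S"
  shows "(\<Sum>c\<in>S. length (filter (\<lambda>p. f p = c) ps) * A c) \<le> (\<Sum>p\<leftarrow>ps. A (f p) :: nat)"
proof (induction ps)
  case (Cons p ps)
  have "(\<Sum>c\<in>S. length (filter (\<lambda>q. f q = c) (p # ps)) * A c)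
      = (\<Sum>c\<in>S. (if f p = c then A c else 0) + length (filter (\<lambda>q. f q = c) ps) * A c)"
    by (intro sum.cong) auto
  also have "\<dots> = (\<Sum>c\<in>S. if f p = c then A c else 0)
      + (\<Sum>c\<in>S. length (filter (\<lambda>q. f q = c) ps) * A c)"
    by (rule sum.distrib)
  also have "(\<Sum>c\<in>S. if f p = c then A c else 0) \<le> A (f p)"
    using assms by (simp add: sum.delta')
  finally show ?case using Cons.IH by simp
qed simp

text \<open>Maximum norm instead of Euclidean distance: adjacency of cells controls each coordinate
  separately, and the neighbourhoods are squares, whose area is immediate.\<close>

definition close :: "real \<Rightarrow> point \<Rightarrow> point \<Rightarrow> bool" where
  "close r p q \<longleftrightarrow> \<bar>fst p - fst q\<bar> \<le> r \<and> \<bar>snd p - snd q\<bar> \<le> r"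

lemma floor_adjacent:
  fixes x y \<delta> :: real
  assumes "\<delta> > 0" "\<bar>\<lfloor>x / \<delta>\<rfloor> - \<lfloor>y / \<delta>\<rfloor>\<bar> \<le> 1"
  shows "\<bar>x - y\<bar> \<le> 2 * \<delta>"
proof -
  have "\<bar>x / \<delta> - y / \<delta>\<bar> \<le> 2" using assms(2) by linarith
  moreover have "\<bar>x / \<delta> - y / \<delta>\<bar> = \<bar>x - y\<bar> / \<delta>"
    using assms(1) by (simp add: abs_divide flip: diff_divide_distrib)
  ultimately show ?thesis using assms(1) by (simp add: divide_le_eq)
qed

text \<open>A point is compared only within five cells, all of whose points are
  \<open>close (2 * \<delta>)\<close> to it; regrouping by points removes the grid from the bound.
  Each point also counts itself on the right, which costs one per point.\<close>

lemma length_search_pairs_le: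
  assumes "\<delta> > 0"
  shows "length (search_pairs g (build_grid \<delta> g ps))
           \<le> (\<Sum>p\<leftarrow>ps. length (filter (close (2 * \<delta>) p) ps))"
proof -
  define L where "L = (\<lambda>c. length (filter (\<lambda>p. cell \<delta> p = c) ps))"
  define A where "A = (\<lambda>(i, j). L (i, j + 1) + L (i, j) + (L (i + 1, j - 1) + (L (i + 1, j) + L (i + 1, j + 1))))"
  define G where "G = build_grid \<delta> g ps"
  have GL: "length (G c) \<le> L c" for c
    by (simp add: G_def L_def build_grid_length_le)
  have A_le: "A (cell \<delta> p) \<le> length (filter (close (2 * \<delta>) p) ps)" for p
  proof -
    obtain a b where ab: "cell \<delta> p = (a, b)" by fastforce
    \<comment> \<open>Equality holds because the five cells are pairwise distinct.\<close>
    have "A (a, b) = length (filter (\<lambda>q. cell \<delta> q \<in> {(a, b + 1), (a, b), (a + 1, b - 1), (a + 1, b), (a + 1, b + 1)}) ps)"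
      unfolding A_def L_def by (induction ps) auto
    also have "\<dots> \<le> length (filter (close (2 * \<delta>) p) ps)"
    proof -
      have imp: "close (2 * \<delta>) p q"
        if "cell \<delta> q \<in> {(a, b + 1), (a, b), (a + 1, b - 1), (a + 1, b), (a + 1, b + 1)}" for q
        unfolding close_def using that ab
        by (intro conjI floor_adjacent assms) (auto simp: cell_def)
      show ?thesis
      proof (induction ps)
        case (Cons q qs)
        then show ?case using imp[of q] by (simp split: if_splits)
      qed simp
    qed
    finally show ?thesis by (simp add: ab)
  qed
  have "length (search_pairs g G) = (\<Sum>i\<in>{1..int g}. \<Sum>j\<in>{1..int g}.
      length (cell_pairs (G (i, j + 1)) (G (i, j)) (G (i + 1, j - 1) @ G (i + 1, j) @ G (i + 1, j + 1))))"
  proof -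
    have "sum_list (concat xss) = (\<Sum>xs\<leftarrow>xss. sum_list xs)" for xss :: "nat list list"
      by (induction xss) auto
    then show ?thesis
      unfolding search_pairs_def length_concat map_concat map_map comp_def
      by (simp add: comp_def sum_list_distinct_conv_sum_set)
  qed
  also have "\<dots> \<le> (\<Sum>i\<in>{1..int g}. \<Sum>j\<in>{1..int g}. L (i, j) * A (i, j))"
  proof (intro sum_mono)
    fix i j
    have "length (cell_pairs (G (i, j + 1)) (G (i, j)) (G (i + 1, j - 1) @ G (i + 1, j) @ G (i + 1, j + 1)))
      \<le> length (G (i, j)) * (length (G (i, j + 1)) + length (G (i, j)) +
          length (G (i + 1, j - 1) @ G (i + 1, j) @ G (i + 1, j + 1)))"
      by (rule length_cell_pairs_le)
    also have "\<dots> \<le> L (i, j) * A (i, j)"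
      unfolding A_def by (simp only: length_append prod.case) (intro mult_mono add_mono GL, auto)
    finally show "length (cell_pairs (G (i, j + 1)) (G (i, j)) (G (i + 1, j - 1) @ G (i + 1, j) @ G (i + 1, j + 1)))
      \<le> L (i, j) * A (i, j)" .
  qed
  also have "\<dots> = (\<Sum>c\<in>{1..int g} \<times> {1..int g}. L c * A c)"
    by (simp add: sum.cartesian_product)
  also have "\<dots> \<le> (\<Sum>p\<leftarrow>ps. A (cell \<delta> p))"
    unfolding L_def by (rule sum_count_mult_le) simp
  also have "\<dots> \<le> (\<Sum>p\<leftarrow>ps. length (filter (close (2 * \<delta>) p) ps))"
    by (intro sum_list_mono A_le)
  finally show ?thesis by (simp add: G_def)
qed

text \<open>The extents are at most 1, so \<open>\<delta> \<le> U2 n\<close>. This replaces a radius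
  that depends on all points by one that depends on \<open>n\<close> alone; whether a pair counts is
  then decided by its two points.\<close>

lemma search_comparisons_le:
  assumes ne: "ps \<noteq> []" and sub: "set ps \<subseteq> {0..1} \<times> {0..1}"
  shows "search_comparisons ps \<le> (\<Sum>p\<leftarrow>ps. length (filter (close (2 * U2 (length ps)) p) ps))"
proof -
  define \<delta> where "\<delta> = rescaled_bound ps"
  have eq: "search_comparisons ps = length (search_pairs (grid_size \<delta>) (build_grid \<delta> (grid_size \<delta>) ps))"
    by (simp add: search_comparisons_def cppMM_def Let_def count_comparisons \<delta>_def)
  show ?thesis
  proof (cases "\<delta> \<le> 0")
    case True
    then show ?thesis by (simp add: eq grid_size_nonpos search_pairs_def)
  next
    case False
    define w h where "w = extent fst ps" and "h = extent snd ps"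
    have wh: "0 \<le> w" "0 \<le> h" "w \<le> 1" "h \<le> 1"
      using ne sub by (auto simp: w_def h_def intro!: extent_nonneg extent_le_1)
    have \<delta>: "\<delta> = delta_bar (length ps) * sqrt (w * h)"
      by (simp add: \<delta>_def rescaled_bound_def w_def h_def)
    have s: "0 \<le> sqrt (w * h)" "sqrt (w * h) \<le> 1"
      using wh by (auto simp: mult_le_one)
    \<comment> \<open>Positivity is read off from \<open>\<delta> > 0\<close>, since
      \<open>delta_bar_ge\<close> does not cover two points.\<close>
    have "delta_bar (length ps) > 0"
      using False s unfolding \<delta> by (simp add: not_le zero_less_mult_iff)
    then have "\<delta> \<le> delta_bar (length ps)"
      using s unfolding \<delta> by (intro mult_left_le) auto
    also have "\<dots> \<le> U2 (length ps)" by (simp add: delta_bar_def)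
    finally have le: "\<delta> \<le> U2 (length ps)" .
    have "search_comparisons ps \<le> (\<Sum>p\<leftarrow>ps. length (filter (close (2 * \<delta>) p) ps))"
      unfolding eq using False by (intro length_search_pairs_le) simp
    also have "\<dots> \<le> (\<Sum>p\<leftarrow>ps. length (filter (close (2 * U2 (length ps)) p) ps))"
    proof (rule sum_list_mono)
      fix p
      have imp: "close (2 * U2 (length ps)) p q" if "close (2 * \<delta>) p q" for q
        using that le by (auto simp: close_def)
      have "length (filter (close (2 * \<delta>) p) qs) \<le> length (filter (close (2 * U2 (length ps)) p) qs)" for qs
        using imp by (induction qs) (auto intro: le_SucI)
      then show "length (filter (close (2 * \<delta>) p) ps) \<le> length (filter (close (2 * U2 (length ps)) p) ps)" .
    qed
    finally show ?thesis .
  qed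
qed

section \<open>Integrals over the unit square\<close>

lemma borel_measurable_point_fst [measurable]: "fst \<in> (borel :: point measure) \<rightarrow>\<^sub>M borel"
  and borel_measurable_point_snd [measurable]: "snd \<in> (borel :: point measure) \<rightarrow>\<^sub>M borel"
  by (auto intro!: borel_measurable_continuous_onI continuous_intros)

lemma borel_measurable_inv_sqrt_dist [measurable]:
  assumes [measurable]: "f \<in> borel_measurable M" "g \<in> borel_measurable M"
  shows "(\<lambda>x. inv_sqrt_dist (f x) (g x)) \<in> borel_measurable M"
  unfolding inv_sqrt_dist_def by measurable

lemma borel_measurable_inv_sqrt_area [measurable]:
  assumes [measurable]: "f \<in> M \<rightarrow>\<^sub>M borel" "g \<in> M \<rightarrow>\<^sub>M borel"
  shows "(\<lambda>x. inv_sqrt_area (f x) (g x)) \<in> borel_measurable M"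
proof -
  have [measurable]: "(\<lambda>x. fst (f x)) \<in> borel_measurable M" "(\<lambda>x. fst (g x)) \<in> borel_measurable M"
    "(\<lambda>x. snd (f x)) \<in> borel_measurable M" "(\<lambda>x. snd (g x)) \<in> borel_measurable M"
    by (auto intro: measurable_compose[OF _ borel_measurable_point_fst]
        measurable_compose[OF _ borel_measurable_point_snd] assms)
  show ?thesis unfolding inv_sqrt_area_def by measurable
qed

lemma pred_close [measurable]:
  assumes [measurable]: "f \<in> M \<rightarrow>\<^sub>M borel" "g \<in> M \<rightarrow>\<^sub>M borel"
  shows "Measurable.pred M (\<lambda>x. close r (f x) (g x))"
proof -
  have [measurable]: "(\<lambda>x. fst (f x)) \<in> borel_measurable M" "(\<lambda>x. fst (g x)) \<in> borel_measurable M"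
    "(\<lambda>x. snd (f x)) \<in> borel_measurable M" "(\<lambda>x. snd (g x)) \<in> borel_measurable M"
    by (auto intro: measurable_compose[OF _ borel_measurable_point_fst]
        measurable_compose[OF _ borel_measurable_point_snd] assms)
  show ?thesis unfolding close_def by measurable
qed

text \<open>Unlike the reciprocal distance, its square root is integrable: the integral is
  \<open>2 * sqrt a + 2 * sqrt (1 - a)\<close>, bounded uniformly in \<open>a\<close>.\<close>

lemma nn_integral_inv_sqrt_dist_le:
  assumes a: "a \<in> {0..1}"
  shows "(\<integral>\<^sup>+x. inv_sqrt_dist a x * indicator {0..1} x \<partial>lborel) \<le> 4"
proof -
  define F where "F = (\<lambda>x. 2 * sqrt (x - a))"
  have "((\<lambda>x. 1 / sqrt \<bar>a - x\<bar>) has_integral (F 1 - F 0)) {0..1}"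
  \<comment> \<open>The exceptional set is the singularity \<open>a\<close>, where \<open>F\<close>
    is continuous but has no derivative.\<close>
  proof (rule fundamental_theorem_of_calculus_interior_strong[of "{a}"])
    show "continuous_on {0..1} F" unfolding F_def by (intro continuous_intros)
    fix x assume "x \<in> {0<..<1} - {a}"
    then have x: "x \<noteq> a" by auto
    \<comment> \<open>\<open>sqrt\<close> is odd, so that \<open>F\<close> is an antiderivative on both sides of \<open>a\<close>.\<close>
    have minus_sqrt: "sqrt (a - x) = - sqrt (x - a)"
      by (simp flip: real_sqrt_minus)
    have "(sqrt has_real_derivative 1 / (2 * sqrt \<bar>a - x\<bar>)) (at (x - a))"
      using x by (intro DERIV_real_sqrt_generic) (auto simp: abs_if inverse_eq_divide minus_sqrt)
    then have "((\<lambda>x. sqrt (x - a)) has_real_derivative 1 / (2 * sqrt \<bar>a - x\<bar>) * 1) (at x)"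
      by (rule DERIV_chain2) (auto intro!: derivative_eq_intros)
    from DERIV_cmult[OF this, of 2] have "(F has_real_derivative 1 / sqrt \<bar>a - x\<bar>) (at x)"
      by (simp add: F_def)
    then show "(F has_vector_derivative 1 / sqrt \<bar>a - x\<bar>) (at x)"
      by (simp add: has_real_derivative_iff_has_vector_derivative)
  qed auto
  then have "((\<lambda>x. if x \<in> {0..1} then 1 / sqrt \<bar>a - x\<bar> else 0) has_integral (F 1 - F 0)) UNIV"
    by (simp only: has_integral_restrict_UNIV)
  also have "(\<lambda>x. if x \<in> {0..1} then 1 / sqrt \<bar>a - x\<bar> else 0)
      = (\<lambda>x. indicator {0..1} x * (1 / sqrt \<bar>a - x\<bar>))"
    by (auto simp: indicator_def)
  finally have "(\<integral>\<^sup>+x. ennreal (indicator {0..1} x * (1 / sqrt \<bar>a - x\<bar>)) \<partial>lborel) = ennreal (F 1 - F 0)"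
    by (intro nn_integral_has_integral_lborel) auto
  also have "F 1 - F 0 = 2 * sqrt (1 - a) + 2 * sqrt a"
    by (simp add: F_def real_sqrt_minus)
  also have "\<dots> \<le> 4"
  proof -
    have "sqrt (1 - a) \<le> 1" "sqrt a \<le> 1" using a by auto
    then show ?thesis by linarith
  qed
  finally have "(\<integral>\<^sup>+x. ennreal (indicator {0..1} x * (1 / sqrt \<bar>a - x\<bar>)) \<partial>lborel) \<le> ennreal 4"
    by (simp add: ennreal_leI)
  moreover have "(\<integral>\<^sup>+x. inv_sqrt_dist a x * indicator {0..1} x \<partial>lborel)
      = (\<integral>\<^sup>+x. ennreal (indicator {0..1} x * (1 / sqrt \<bar>a - x\<bar>)) \<partial>lborel)"
  \<comment> \<open>The integrands differ at \<open>x = a\<close>, where the left one is infinite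
    and the right one is 0.\<close>
  proof (rule nn_integral_cong_AE)
    have "AE x in lborel. x \<noteq> a" by (rule AE_lborel_singleton)
    then show "AE x in lborel. inv_sqrt_dist a x * indicator {0..1} x
        = ennreal (indicator {0..1} x * (1 / sqrt \<bar>a - x\<bar>))"
      by eventually_elim (auto simp: inv_sqrt_dist_def indicator_def inverse_ennreal inverse_eq_divide)
  qed
  ultimately show ?thesis by simp
qed

section \<open>The uniform distribution on the unit square\<close>

definition uniform_square :: "point measure" where
  "uniform_square = uniform_measure lborel ({0..1} \<times> {0..1})"

lemma unit_square_measurable [measurable]: "({0..1} \<times> {0..1} :: point set) \<in> sets borel"
proof -
  have "({0..1} \<times> {0..1} :: point set) = cbox (0, 0) (1, 1)" by (auto simp: cbox_Pair_eq)
  then show ?thesis by simp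
qed

lemma emeasure_unit_square: "emeasure lborel ({0..1} \<times> {0..1} :: point set) = 1"
proof -
  have "({0..1} \<times> {0..1} :: point set) = cbox (0, 0) (1, 1)" by (auto simp: cbox_Pair_eq)
  then show ?thesis by (simp add: emeasure_lborel_cbox_eq Basis_prod_def)
qed

lemma sets_uniform_square [measurable_cong, simp]: "sets uniform_square = sets borel"
  by (simp add: uniform_square_def)

lemma space_uniform_square [simp]: "space uniform_square = UNIV"
  by (simp add: uniform_square_def)

lemma prob_space_uniform_square: "prob_space uniform_square"
  unfolding uniform_square_def using emeasure_unit_square
  by (intro prob_space_uniform_measure) auto

lemma nn_integral_uniform_square:
  assumes [measurable]: "f \<in> borel_measurable borel"
  shows "(\<integral>\<^sup>+p. f p \<partial>uniform_square) = (\<integral>\<^sup>+p. indicator ({0..1} \<times> {0..1}) p * f p \<partial>lborel)"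
  unfolding uniform_square_def uniform_measure_def emeasure_unit_square
  by (subst nn_integral_density) (auto simp: divide_ennreal_def)

lemma AE_uniform_square: "AE p in uniform_square. p \<in> {0..1} \<times> {0..1}"
  unfolding uniform_square_def by (rule AE_uniform_measureI) auto

text \<open>The integrand is a product over the coordinates, so Fubini splits the integral into two
  factors of at most 4.\<close>

lemma nn_integral_inv_sqrt_area_le:
  assumes p: "p \<in> {0..1} \<times> {0..1}"
  shows "(\<integral>\<^sup>+q. inv_sqrt_area p q \<partial>uniform_square) \<le> 16"
proof -
  define u where "u = (\<lambda>x. inv_sqrt_dist (fst p) x * indicator {0..1} x)"
  define v where "v = (\<lambda>y. inv_sqrt_dist (snd p) y * indicator {0..1} y)"
  have [measurable]: "u \<in> borel_measurable borel" "v \<in> borel_measurable borel"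
    by (simp_all add: u_def v_def)
  have "(\<integral>\<^sup>+q. inv_sqrt_area p q \<partial>uniform_square) = (\<integral>\<^sup>+q. u (fst q) * v (snd q) \<partial>(lborel \<Otimes>\<^sub>M lborel))"
    unfolding lborel_prod
    by (subst nn_integral_uniform_square)
      (auto intro!: nn_integral_cong simp: inv_sqrt_area_def u_def v_def indicator_def)
  also have "\<dots> = (\<integral>\<^sup>+x. \<integral>\<^sup>+y. u x * v y \<partial>lborel \<partial>lborel)"
    by (subst lborel.nn_integral_fst[symmetric]) auto
  also have "\<dots> = (\<integral>\<^sup>+x. u x \<partial>lborel) * (\<integral>\<^sup>+y. v y \<partial>lborel)"
    by (simp add: nn_integral_cmult nn_integral_multc)
  also have "\<dots> \<le> 4 * 4"
    unfolding u_def v_def using p by (intro mult_mono nn_integral_inv_sqrt_dist_le) auto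
  finally show ?thesis by simp
qed

text \<open>The neighbourhood is a square of side \<open>2 * r\<close>; intersecting it with the
  unit square can only reduce its area.\<close>

lemma nn_integral_close_le:
  assumes "r \<ge> 0"
  shows "(\<integral>\<^sup>+q. indicator {q. close r p q} q \<partial>uniform_square) \<le> ennreal (4 * r\<^sup>2)"
proof -
  have [measurable]: "{q. close r p q} \<in> sets borel" by measurable
  have "(\<integral>\<^sup>+q. indicator {q. close r p q} q \<partial>uniform_square)
      \<le> (\<integral>\<^sup>+q. indicator (cbox (fst p - r, snd p - r) (fst p + r, snd p + r)) q \<partial>lborel)"
    by (subst nn_integral_uniform_square)
      (auto intro!: nn_integral_mono simp: indicator_def close_def cbox_Pair_eq)
  also have "\<dots> = emeasure lborel (cbox (fst p - r, snd p - r) (fst p + r, snd p + r))"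
    by (subst nn_integral_indicator) auto
  also have "\<dots> = ennreal (4 * r\<^sup>2)"
    using assms by (simp add: emeasure_lborel_cbox_eq Basis_prod_def inner_Pair power2_eq_square)
  finally show ?thesis .
qed

section \<open>Expectations\<close>

locale uniform_points = prob_space M for M :: "'w measure" +
  fixes n :: nat and P :: "nat \<Rightarrow> 'w \<Rightarrow> point"
  assumes indep: "indep_vars (\<lambda>_. borel) P {1..n}"
    and distr_point: "i \<in> {1..n} \<Longrightarrow> distr M borel (P i) = uniform_square"
begin

sublocale U: prob_space uniform_square
  by (rule prob_space_uniform_square)

lemma point_measurable: "i \<in> {1..n} \<Longrightarrow> P i \<in> M \<rightarrow>\<^sub>M borel"
  using indep by (auto simp: indep_vars_def)

lemma AE_point:
  assumes "i \<in> {1..n}"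
  shows "AE \<omega> in M. P i \<omega> \<in> {0..1} \<times> {0..1}"
proof -
  have "AE p in distr M borel (P i). p \<in> {0..1} \<times> {0..1}"
    unfolding distr_point[OF assms] by (rule AE_uniform_square)
  then show ?thesis
    using point_measurable[OF assms] unit_square_measurable by (subst (asm) AE_distr_iff) auto
qed

text \<open>Independence of the index blocks \<open>{i}\<close> and \<open>{j}\<close> passes to the
  points themselves by evaluation at the index.\<close>

lemma distr_pair:
  assumes "i \<in> {1..n}" "j \<in> {1..n}" "i \<noteq> j"
  shows "distr M (borel \<Otimes>\<^sub>M borel) (\<lambda>\<omega>. (P i \<omega>, P j \<omega>)) = uniform_square \<Otimes>\<^sub>M uniform_square"
proof -
  have "indep_var (Pi\<^sub>M {i} (\<lambda>_. borel)) (\<lambda>\<omega>. restrict (\<lambda>k. P k \<omega>) {i})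
                  (Pi\<^sub>M {j} (\<lambda>_. borel)) (\<lambda>\<omega>. restrict (\<lambda>k. P k \<omega>) {j})"
    by (rule indep_var_restrict[OF indep]) (use assms in auto)
  from indep_var_compose[OF this, of "\<lambda>x. x i" borel "\<lambda>x. x j" borel]
  have "indep_var borel (P i) borel (P j)" by (simp add: comp_def)
  then show ?thesis using assms by (simp add: indep_var_distribution_eq distr_point)
qed

lemma expected_close_le:
  assumes ij: "i \<in> {1..n}" "j \<in> {1..n}" "i \<noteq> j" and r: "r \<ge> 0"
  shows "(\<integral>\<^sup>+\<omega>. of_bool (close r (P i \<omega>) (P j \<omega>)) \<partial>M) \<le> ennreal (4 * r\<^sup>2)"
proof -
  note [measurable] = point_measurable[OF ij(1)] point_measurable[OF ij(2)]
  define f :: "point \<times> point \<Rightarrow> ennreal" where "f = (\<lambda>z. of_bool (close r (fst z) (snd z)))"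
  have [measurable]: "f \<in> borel_measurable (borel \<Otimes>\<^sub>M borel)"
    unfolding f_def by measurable
  have "(\<integral>\<^sup>+\<omega>. of_bool (close r (P i \<omega>) (P j \<omega>)) \<partial>M) = (\<integral>\<^sup>+\<omega>. f (P i \<omega>, P j \<omega>) \<partial>M)"
    by (intro nn_integral_cong) (auto simp: f_def)
  also have "\<dots> = (\<integral>\<^sup>+z. f z \<partial>distr M (borel \<Otimes>\<^sub>M borel) (\<lambda>\<omega>. (P i \<omega>, P j \<omega>)))"
    by (rule nn_integral_distr[symmetric]) measurable
  also have "\<dots> = (\<integral>\<^sup>+p. \<integral>\<^sup>+q. f (p, q) \<partial>uniform_square \<partial>uniform_square)"
    unfolding distr_pair[OF ij] by (rule U.nn_integral_fst[symmetric]) measurable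
  also have "\<dots> \<le> (\<integral>\<^sup>+p. ennreal (4 * r\<^sup>2) \<partial>uniform_square)"
  proof (intro nn_integral_mono)
    fix p
    have "(\<integral>\<^sup>+q. f (p, q) \<partial>uniform_square) = (\<integral>\<^sup>+q. indicator {q. close r p q} q \<partial>uniform_square)"
      by (intro nn_integral_cong) (auto simp: f_def indicator_def)
    then show "(\<integral>\<^sup>+q. f (p, q) \<partial>uniform_square) \<le> ennreal (4 * r\<^sup>2)"
      using nn_integral_close_le[OF r, of p] by simp
  qed
  also have "\<dots> = ennreal (4 * r\<^sup>2)" using U.emeasure_space_1 by simp
  finally show ?thesis .
qed

text \<open>For fixed \<open>P i\<close> the two factors are independent, each with mean at most 16.
  This is why the distances are measured from one common point.\<close>

lemma expected_inv_area_le: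
  assumes ijk: "i \<in> {1..n}" "j \<in> {1..n}" "k \<in> {1..n}" "i \<noteq> j" "i \<noteq> k" "j \<noteq> k"
  shows "(\<integral>\<^sup>+\<omega>. inv_sqrt_area (P i \<omega>) (P j \<omega>) * inv_sqrt_area (P i \<omega>) (P k \<omega>) \<partial>M) \<le> 256"
proof -
  note [measurable] = point_measurable[OF ijk(1)] point_measurable[OF ijk(2)] point_measurable[OF ijk(3)]
  have "indep_var (Pi\<^sub>M {i} (\<lambda>_. borel)) (\<lambda>\<omega>. restrict (\<lambda>k. P k \<omega>) {i})
                  (Pi\<^sub>M {j, k} (\<lambda>_. borel)) (\<lambda>\<omega>. restrict (\<lambda>k. P k \<omega>) {j, k})"
    by (rule indep_var_restrict[OF indep]) (use ijk in auto)
  \<comment> \<open>\<open>P i\<close> is duplicated as \<^const>\<open>indep_var\<close> relates variables of the same type only.\<close>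
  from indep_var_compose[OF this, of "\<lambda>x. (x i, x i)" "borel \<Otimes>\<^sub>M borel" "\<lambda>x. (x j, x k)" "borel \<Otimes>\<^sub>M borel"]
  have ind: "indep_var (borel \<Otimes>\<^sub>M borel) (\<lambda>\<omega>. (P i \<omega>, P i \<omega>)) (borel \<Otimes>\<^sub>M borel) (\<lambda>\<omega>. (P j \<omega>, P k \<omega>))"
    by (simp add: comp_def)
  interpret UU: prob_space "distr M (borel \<Otimes>\<^sub>M borel) (\<lambda>\<omega>. (P j \<omega>, P k \<omega>))"
    by (rule prob_space_distr) measurable
  define f :: "(point \<times> point) \<times> point \<times> point \<Rightarrow> ennreal"
    where "f = (\<lambda>z. inv_sqrt_area (fst (fst z)) (fst (snd z)) * inv_sqrt_area (fst (fst z)) (snd (snd z)))"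
  have [measurable]: "f \<in> borel_measurable ((borel \<Otimes>\<^sub>M borel) \<Otimes>\<^sub>M (borel \<Otimes>\<^sub>M borel))"
    unfolding f_def by measurable
  let ?D = "distr M (borel \<Otimes>\<^sub>M borel) (\<lambda>\<omega>. (P i \<omega>, P i \<omega>))"
  let ?E = "distr M (borel \<Otimes>\<^sub>M borel) (\<lambda>\<omega>. (P j \<omega>, P k \<omega>))"
  have "(\<integral>\<^sup>+\<omega>. inv_sqrt_area (P i \<omega>) (P j \<omega>) * inv_sqrt_area (P i \<omega>) (P k \<omega>) \<partial>M)
      = (\<integral>\<^sup>+\<omega>. f ((P i \<omega>, P i \<omega>), (P j \<omega>, P k \<omega>)) \<partial>M)"
    by (simp add: f_def)
  also have "\<dots> = (\<integral>\<^sup>+z. f z \<partial>distr M ((borel \<Otimes>\<^sub>M borel) \<Otimes>\<^sub>M (borel \<Otimes>\<^sub>M borel))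
      (\<lambda>\<omega>. ((P i \<omega>, P i \<omega>), (P j \<omega>, P k \<omega>))))"
    by (rule nn_integral_distr[symmetric]) measurable
  also have "\<dots> = (\<integral>\<^sup>+z. f z \<partial>(?D \<Otimes>\<^sub>M ?E))"
    using ind by (simp add: indep_var_distribution_eq)
  also have "\<dots> = (\<integral>\<^sup>+a. \<integral>\<^sup>+z. f (a, z) \<partial>?E \<partial>?D)"
    by (rule UU.nn_integral_fst[symmetric]) measurable
  \<comment> \<open>The outer integral returns to \<open>M\<close>, where \<open>AE_point\<close>
    places \<open>P i \<omega>\<close> in the square, as the bound 16 requires.\<close>
  also have "\<dots> = (\<integral>\<^sup>+\<omega>. \<integral>\<^sup>+z. f ((P i \<omega>, P i \<omega>), z) \<partial>?E \<partial>M)"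
    by (rule nn_integral_distr) measurable
  also have "\<dots> \<le> (\<integral>\<^sup>+\<omega>. 256 \<partial>M)"
  proof (rule nn_integral_mono_AE)
    show "AE \<omega> in M. (\<integral>\<^sup>+z. f ((P i \<omega>, P i \<omega>), z) \<partial>?E) \<le> 256"
      using AE_point[OF ijk(1)]
    proof eventually_elim
      case (elim \<omega>)
      define p where "p = P i \<omega>"
      have "(\<integral>\<^sup>+z. f ((p, p), z) \<partial>?E) = (\<integral>\<^sup>+z. inv_sqrt_area p (fst z) * inv_sqrt_area p (snd z)
          \<partial>(uniform_square \<Otimes>\<^sub>M uniform_square))"
        unfolding distr_pair[OF ijk(2,3,6)] by (simp add: f_def)
      also have "\<dots> = (\<integral>\<^sup>+q. \<integral>\<^sup>+r. inv_sqrt_area p q * inv_sqrt_area p r \<partial>uniform_square \<partial>uniform_square)"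
        by (subst U.nn_integral_fst[symmetric]) auto
      also have "\<dots> = (\<integral>\<^sup>+q. inv_sqrt_area p q \<partial>uniform_square) * (\<integral>\<^sup>+r. inv_sqrt_area p r \<partial>uniform_square)"
        by (simp add: nn_integral_cmult nn_integral_multc)
      also have "\<dots> \<le> 16 * 16"
        using elim unfolding p_def by (intro mult_mono nn_integral_inv_sqrt_area_le) auto
      finally show ?case by (simp add: p_def)
    qed
  qed
  also have "\<dots> = 256" by (simp add: emeasure_space_1)
  finally show ?thesis .
qed

abbreviation points :: "'w \<Rightarrow> point list" where
  "points \<omega> \<equiv> map (\<lambda>i. P i \<omega>) [1..<n + 1]"

lemma set_points: "set (points \<omega>) = (\<lambda>i. P i \<omega>) ` {1..n}"
  by auto

text \<open>
  Measurable majorants are integrated in place of the step counts, since the integral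
  \<open>nn_integral\<close> is additive only for measurable functions.
\<close>

lemma bucket_majorant:
  assumes n: "n \<ge> 3"
  obtains X where "X \<in> borel_measurable M" "(\<integral>\<^sup>+\<omega>. X \<omega> \<partial>M) \<le> ennreal (2050 * real n)"
    "\<And>\<omega>. of_nat ((grid_size (rescaled_bound (points \<omega>)))\<^sup>2) \<le> X \<omega>"
proof
  have mem: "1 \<in> {1..n}" "2 \<in> {1..n}" "3 \<in> {1..n}" using n by auto
  note [measurable] = point_measurable[OF mem(1)] point_measurable[OF mem(2)] point_measurable[OF mem(3)]
  let ?X = "\<lambda>\<omega>. 2 + ennreal (8 * real n) *
            (inv_sqrt_area (P 1 \<omega>) (P 2 \<omega>) * inv_sqrt_area (P 1 \<omega>) (P 3 \<omega>))"
  show "?X \<in> borel_measurable M" by measurable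
  show "of_nat ((grid_size (rescaled_bound (points \<omega>)))\<^sup>2) \<le> ?X \<omega>" for \<omega>
  proof -
    have "P i \<omega> \<in> set (points \<omega>)" if "i \<in> {1..n}" for i
      using that unfolding set_points by blast
    from this[OF mem(1)] this[OF mem(2)] this[OF mem(3)] show ?thesis
      using grid_size_sq_le[of "points \<omega>" "P 1 \<omega>" "P 2 \<omega>" "P 3 \<omega>"] n by simp
  qed
  have [measurable]: "(\<lambda>\<omega>. inv_sqrt_area (P 1 \<omega>) (P 2 \<omega>) * inv_sqrt_area (P 1 \<omega>) (P 3 \<omega>)) \<in> borel_measurable M"
    by measurable
  have "(\<integral>\<^sup>+\<omega>. ?X \<omega> \<partial>M) = 2 + ennreal (8 * real n) *
      (\<integral>\<^sup>+\<omega>. inv_sqrt_area (P 1 \<omega>) (P 2 \<omega>) * inv_sqrt_area (P 1 \<omega>) (P 3 \<omega>) \<partial>M)"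
    by (subst nn_integral_add, measurable, subst nn_integral_cmult, measurable) (simp add: emeasure_space_1)
  also have "\<dots> \<le> 2 + ennreal (8 * real n) * 256"
    using mem by (intro add_left_mono mult_left_mono expected_inv_area_le) auto
  also have "\<dots> = ennreal (2 + (8 * real n) * 256)"
    by (subst ennreal_plus; (subst ennreal_mult)?; simp del: ennreal_mult'')
  \<comment> \<open>\<open>8 * 256 = 2048\<close>, and the summand 2 is at most
    \<open>2 * n\<close>.\<close>
  also have "\<dots> \<le> ennreal (2050 * real n)"
    using n by (intro ennreal_leI) simp
  finally show "(\<integral>\<^sup>+\<omega>. ?X \<omega> \<partial>M) \<le> ennreal (2050 * real n)" .
qed

text \<open>Linearity over the \<open>n * n\<close> ordered index pairs: the diagonal contributes at
  most \<open>n\<close>, and \<open>288 / n\<close> per pair adds up to \<open>288 * n\<close>. The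
  majorant holds only almost everywhere, since the points have to lie in the square.\<close>

lemma comparison_majorant:
  assumes n: "n \<ge> 2"
  obtains Y where "Y \<in> borel_measurable M" "(\<integral>\<^sup>+\<omega>. Y \<omega> \<partial>M) \<le> ennreal (289 * real n)"
    "AE \<omega> in M. of_nat (search_comparisons (points \<omega>)) \<le> Y \<omega>"
proof
  define r where "r = 2 * U2 n"
  have r: "r \<ge> 0" using U2_nonneg[OF n] by (simp add: r_def)
  \<comment> \<open>\<open>4 * r\<^sup>2 = 16 * (U2 n)\<^sup>2\<close>, and
    \<open>16 * 18 = 288\<close>.\<close>
  have "4 * r\<^sup>2 \<le> 288 / real n"
    using U2_sq_le[OF n] by (simp add: r_def power_mult_distrib)
  have le: "(\<integral>\<^sup>+\<omega>. of_bool (close r (P i \<omega>) (P j \<omega>)) \<partial>M) \<le> ennreal (of_bool (i = j) + 288 / real n)"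
    if "i \<in> {1..n}" "j \<in> {1..n}" for i j
  proof (cases "i = j")
    case True
    have "(\<integral>\<^sup>+\<omega>. of_bool (close r (P i \<omega>) (P j \<omega>)) \<partial>M) \<le> (\<integral>\<^sup>+\<omega>. 1 \<partial>M)"
      by (intro nn_integral_mono) auto
    also have "\<dots> = ennreal 1" by (simp add: emeasure_space_1)
    also have "\<dots> \<le> ennreal (of_bool (i = j) + 288 / real n)"
      using True by (intro ennreal_leI) simp
    finally show ?thesis .
  next
    case False
    have "(\<integral>\<^sup>+\<omega>. of_bool (close r (P i \<omega>) (P j \<omega>)) \<partial>M) \<le> ennreal (4 * r\<^sup>2)"
      by (rule expected_close_le[OF that False r])
    also have "\<dots> \<le> ennreal (of_bool (i = j) + 288 / real n)"
      using \<open>4 * r\<^sup>2 \<le> 288 / real n\<close> False by (intro ennreal_leI) simp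
    finally show ?thesis .
  qed
  let ?Y = "\<lambda>\<omega>. \<Sum>i\<in>{1..n}. \<Sum>j\<in>{1..n}. of_bool (close r (P i \<omega>) (P j \<omega>)) :: ennreal"
  have meas: "(\<lambda>\<omega>. of_bool (close r (P i \<omega>) (P j \<omega>)) :: ennreal) \<in> borel_measurable M"
    if "i \<in> {1..n}" "j \<in> {1..n}" for i j
  proof -
    note [measurable] = point_measurable[OF that(1)] point_measurable[OF that(2)]
    show ?thesis by measurable
  qed
  show "?Y \<in> borel_measurable M"
    by (intro borel_measurable_sum meas)
  show "AE \<omega> in M. of_nat (search_comparisons (points \<omega>)) \<le> ?Y \<omega>"
  proof -
    have "AE \<omega> in M. \<forall>i\<in>{1..n}. P i \<omega> \<in> {0..1} \<times> {0..1}"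
      by (intro AE_finite_allI AE_point) auto
    then show ?thesis
    proof eventually_elim
      case (elim \<omega>)
      have count: "length (filter Q (points \<omega>)) = (\<Sum>j\<in>{1..n}. of_bool (Q (P j \<omega>)))" for Q
      proof -
        have "length (filter Q (map f xs)) = (\<Sum>x\<leftarrow>xs. of_bool (Q (f x)))" for xs and f :: "nat \<Rightarrow> point"
          by (induction xs) auto
        then have "length (filter Q (points \<omega>)) = (\<Sum>j\<leftarrow>[1..<n + 1]. of_bool (Q (P j \<omega>)))" .
        then show ?thesis
          by (simp only: interv_sum_list_conv_sum_set_nat set_upt)
            (simp only: Suc_eq_plus1[symmetric] atLeastLessThanSuc_atLeastAtMost)
      qed
      have "search_comparisons (points \<omega>)
          \<le> (\<Sum>p\<leftarrow>points \<omega>. length (filter (close (2 * U2 (length (points \<omega>))) p) (points \<omega>)))"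
        by (rule search_comparisons_le) (use n elim set_points in auto)
      also have "\<dots> = (\<Sum>p\<leftarrow>points \<omega>. \<Sum>j\<in>{1..n}. of_bool (close r p (P j \<omega>)))"
        by (simp only: count r_def) simp
      also have "\<dots> = (\<Sum>i\<leftarrow>[1..<n + 1]. \<Sum>j\<in>{1..n}. of_bool (close r (P i \<omega>) (P j \<omega>)))"
        by (simp only: map_map comp_def)
      also have "\<dots> = (\<Sum>i\<in>{1..n}. \<Sum>j\<in>{1..n}. of_bool (close r (P i \<omega>) (P j \<omega>)))"
        by (simp only: interv_sum_list_conv_sum_set_nat set_upt)
          (simp only: Suc_eq_plus1[symmetric] atLeastLessThanSuc_atLeastAtMost)
      finally have "(of_nat (search_comparisons (points \<omega>)) :: ennreal)
          \<le> of_nat (\<Sum>i\<in>{1..n}. \<Sum>j\<in>{1..n}. of_bool (close r (P i \<omega>) (P j \<omega>)))"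
        by (rule of_nat_mono)
      then show ?case by simp
    qed
  qed
  have "(\<integral>\<^sup>+\<omega>. ?Y \<omega> \<partial>M) = (\<Sum>i\<in>{1..n}. \<integral>\<^sup>+\<omega>. (\<Sum>j\<in>{1..n}. of_bool (close r (P i \<omega>) (P j \<omega>))) \<partial>M)"
    by (intro nn_integral_sum borel_measurable_sum meas)
  also have "\<dots> = (\<Sum>i\<in>{1..n}. \<Sum>j\<in>{1..n}. \<integral>\<^sup>+\<omega>. of_bool (close r (P i \<omega>) (P j \<omega>)) \<partial>M)"
    by (intro sum.cong refl nn_integral_sum meas)
  also have "\<dots> \<le> (\<Sum>i\<in>{1..n}. \<Sum>j\<in>{1..n}. ennreal (of_bool (i = j) + 288 / real n))"
    by (intro sum_mono le)
  also have "\<dots> = ennreal (\<Sum>i\<in>{1..n}. \<Sum>j\<in>{1..n}. of_bool (i = j) + 288 / real n)"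
    by (subst sum_ennreal[symmetric], simp add: sum_nonneg, intro sum.cong refl,
        subst sum_ennreal[symmetric], simp_all)
  also have "(\<Sum>i\<in>{1..n}. \<Sum>j\<in>{1..n}. of_bool (i = j) + 288 / real n) = 289 * real n"
    using n by (simp add: sum.distrib of_bool_def)
  finally show "(\<integral>\<^sup>+\<omega>. ?Y \<omega> \<partial>M) \<le> ennreal (289 * real n)" .
qed

end

text \<open>The condition for \<open>n = 2\<close> is forced by
  \<open>expected_steps_two_infinite\<close>. The constant depends on the step costs only.\<close>

theorem theorem2:
  fixes \<kappa> :: step_costs
  shows "\<exists>C::real. \<forall>n\<ge>2. \<forall>(M :: 'w measure) P.
           iid_uniform_points n M P \<longrightarrow>
           (n = 2 \<longrightarrow> bucket_cost \<kappa> = 0) \<longrightarrow>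
           expected_steps \<kappa> n M P \<le> ennreal (C * real n)"
proof -
  define a where "a = real (bound_cost \<kappa> + rescale_cost \<kappa> + init_cost \<kappa>)"
  define b where "b = real (extent_cost \<kappa> + insert_cost \<kappa>)"
  define c where "c = real (bucket_cost \<kappa>)"
  \<comment> \<open>2050 and 289 come from the two majorants; the fixed costs \<open>a\<close> are
    absorbed by \<open>a \<le> a * n\<close>.\<close>
  define C where "C = a + b + 2050 * c + 289"
  have nn: "a \<ge> 0" "b \<ge> 0" "c \<ge> 0" by (simp_all add: a_def b_def c_def)
  have "expected_steps \<kappa> n M P \<le> ennreal (C * real n)"
    if n: "n \<ge> 2" and iid: "iid_uniform_points n M P" and two: "n = 2 \<longrightarrow> bucket_cost \<kappa> = 0"
    for n and M :: "'w measure" and P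
  proof -
    interpret uniform_points M n P
      using iid by (simp add: uniform_points_def uniform_points_axioms_def iid_uniform_points_def
          uniform_square_def)
    \<comment> \<open>The factor \<open>c\<close> is kept inside so that one form serves both cases:
      for \<open>n = 2\<close> it is 0 and the zero function suffices.\<close>
    obtain X where X[measurable]: "X \<in> borel_measurable M"
      and X_int: "(\<integral>\<^sup>+\<omega>. ennreal c * X \<omega> \<partial>M) \<le> ennreal (c * (2050 * real n))"
      and X_ge: "\<And>\<omega>. ennreal c * of_nat ((grid_size (rescaled_bound (points \<omega>)))\<^sup>2) \<le> ennreal c * X \<omega>"
    proof (cases "n = 2")
      case True
      then show ?thesis using two by (intro that[of "\<lambda>_. 0"]) (auto simp: c_def)
    next
      case False
      with n have "n \<ge> 3" by simp
      then obtain X where X: "X \<in> borel_measurable M" "(\<integral>\<^sup>+\<omega>. X \<omega> \<partial>M) \<le> ennreal (2050 * real n)"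
        "\<And>\<omega>. of_nat ((grid_size (rescaled_bound (points \<omega>)))\<^sup>2) \<le> X \<omega>"
        by (rule bucket_majorant) blast
      have "(\<integral>\<^sup>+\<omega>. ennreal c * X \<omega> \<partial>M) \<le> ennreal c * ennreal (2050 * real n)"
        using X by (simp add: nn_integral_cmult mult_left_mono)
      then show ?thesis
        using X nn by (intro that[of X] mult_left_mono) (auto simp: ennreal_mult)
    qed
    obtain Y where Y[measurable]: "Y \<in> borel_measurable M"
      and Y_int: "(\<integral>\<^sup>+\<omega>. Y \<omega> \<partial>M) \<le> ennreal (289 * real n)"
      and Y_ge: "AE \<omega> in M. of_nat (search_comparisons (points \<omega>)) \<le> Y \<omega>"
      by (rule comparison_majorant[OF n]) blast
    have "expected_steps \<kappa> n M P \<le> (\<integral>\<^sup>+\<omega>. ennreal (a + b * real n) + (ennreal c * X \<omega> + Y \<omega>) \<partial>M)"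
      unfolding expected_steps_def
    proof (rule nn_integral_mono_AE)
      show "AE \<omega> in M. of_nat (total_steps \<kappa> (points \<omega>)) \<le> ennreal (a + b * real n) + (ennreal c * X \<omega> + Y \<omega>)"
        using Y_ge
      proof eventually_elim
        case (elim \<omega>)
        define g where "g = (grid_size (rescaled_bound (points \<omega>)))\<^sup>2"
        define k where "k = search_comparisons (points \<omega>)"
        have "real (total_steps \<kappa> (points \<omega>)) = a + b * real n + (c * real g + real k)"
          unfolding total_steps_def precomputation_steps_def g_def[symmetric] k_def[symmetric]
          by (simp add: a_def b_def c_def algebra_simps del: upt_Suc)
        then have "(of_nat (total_steps \<kappa> (points \<omega>)) :: ennreal)
            = ennreal (a + b * real n) + (ennreal c * of_nat g + of_nat k)"
          using nn by (simp add: ennreal_of_nat_eq_real_of_nat ennreal_plus ennreal_mult)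
        also have "\<dots> \<le> ennreal (a + b * real n) + (ennreal c * X \<omega> + Y \<omega>)"
          using X_ge[of \<omega>] elim by (intro add_left_mono add_mono) (simp_all add: g_def k_def)
        finally show ?case .
      qed
    qed
    also have "\<dots> = ennreal (a + b * real n) + ((\<integral>\<^sup>+\<omega>. ennreal c * X \<omega> \<partial>M) + (\<integral>\<^sup>+\<omega>. Y \<omega> \<partial>M))"
      by (simp add: nn_integral_add emeasure_space_1)
    also have "\<dots> \<le> ennreal (a + b * real n) + (ennreal (c * (2050 * real n)) + ennreal (289 * real n))"
      using X_int Y_int by (intro add_left_mono add_mono)
    also have "\<dots> = ennreal (a + b * real n + (c * (2050 * real n) + 289 * real n))"
      using nn by (simp add: ennreal_plus)
    also have "\<dots> \<le> ennreal (C * real n)"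
    proof (rule ennreal_leI)
      have "a * 1 \<le> a * real n" using nn n by (intro mult_left_mono) auto
      then show "a + b * real n + (c * (2050 * real n) + 289 * real n) \<le> C * real n"
        by (simp add: C_def algebra_simps)
    qed
    finally show ?thesis .
  qed
  then show ?thesis by blast
qed

end
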